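(* Let $n\ge 9$ be odd. If $G$ is a simple graph with $n$ vertices and $m$ edges that has a maximal edge coloring, then $m \ge \frac14 n^2+\frac12 n-\frac34$. Equivalently, every $m\in MEC(n)$ satisfies $m \ge \frac14 n^2+\frac12 n-\frac34$.
   Context: All graphs are finite and simple. The chromatic index of the complete graph is $\chi'(K_n)=n-1$ for even $n$ and $\chi'(K_n)=n$ for odd $n$. A graph $G$ of order $n$ has a maximal edge coloring if there is a proper edge coloring of $G$ using a palette of $\chi'(K_n)$ colors such that adding to $G$ any edge not already in $G$, in any color of the palette, makes the coloring improper (i.e., for every non-adjacent pair of distinct vertices $u,v$ and every color $c$ of the palette, $c$ already appears on an edge incident to $u$ or to $v$). $MEC(n)$ is the set of all nonnegative integers $m$ such that there exists a graph with $n$ vertices and $m$ edges having a maximal edge coloring. *)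

theory Defs
  imports Complex_Main "HOL-Library.Ramsey"
begin

text \<open>A graph is a vertex set \<open>V\<close> together with a set \<open>E\<close> of two-element subsets of \<open>V\<close>.\<close>

definition simple_graph :: "'a set \<Rightarrow> 'a set set \<Rightarrow> bool" where
  "simple_graph V E \<longleftrightarrow> finite V \<and> E \<subseteq> nsets V 2"

text \<open>The palette \<open>P\<close> is the set of available colors; not all of them have to occur.\<close>

definition proper_edge_coloring :: "'a set set \<Rightarrow> 'c set \<Rightarrow> ('a set \<Rightarrow> 'c) \<Rightarrow> bool" where
  "proper_edge_coloring E P c \<longleftrightarrow>
     c ` E \<subseteq> P \<and> (\<forall>e\<in>E. \<forall>f\<in>E. e \<noteq> f \<and> e \<inter> f \<noteq> {} \<longrightarrow> c e \<noteq> c f)"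

lemma proper_edge_coloringD:
  assumes "proper_edge_coloring E P c" "e \<in> E" "f \<in> E" "e \<noteq> f" "e \<inter> f \<noteq> {}"
  shows "c e \<noteq> c f"
  using assms by (simp add: proper_edge_coloring_def)

definition chromatic_index :: "'a set set \<Rightarrow> nat" where
  "chromatic_index E = (LEAST k. \<exists>c. proper_edge_coloring E {..<k} c)"

definition complete_graph_edges :: "nat \<Rightarrow> nat set set" where
  "complete_graph_edges n = nsets {..<n} 2"

definition maximal_edge_coloring :: "'a set \<Rightarrow> 'a set set \<Rightarrow> 'c set \<Rightarrow> ('a set \<Rightarrow> 'c) \<Rightarrow> bool" where
  "maximal_edge_coloring V E P c \<longleftrightarrow>
     proper_edge_coloring E P c \<and>
     (\<forall>e \<in> nsets V 2 - E. \<forall>a\<in>P. \<not> proper_edge_coloring (insert e E) P (c(e := a)))"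

definition has_maximal_edge_coloring :: "'a set \<Rightarrow> 'a set set \<Rightarrow> bool" where
  "has_maximal_edge_coloring V E \<longleftrightarrow>
     (\<exists>c. maximal_edge_coloring V E {..<chromatic_index (complete_graph_edges (card V))} c)"

text \<open>Every finite graph is isomorphic to one whose vertices are natural numbers, so restricting
  the vertex type to \<^typ>\<open>nat\<close> loses no value of \<open>m\<close>.\<close>

definition MEC :: "nat \<Rightarrow> nat set" where
  "MEC n = {m. \<exists>(V :: nat set) E. simple_graph V E \<and> card V = n \<and> card E = m \<and>
                 has_maximal_edge_coloring V E}"

text \<open>The pointwise form of maximality: at every non-adjacent pair, each color of the palette
  already occurs on an edge incident to one of the two vertices.\<close>

lemma maximal_edge_coloring_iff:
  "maximal_edge_coloring V E P c \<longleftrightarrow>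
     proper_edge_coloring E P c \<and>
     (\<forall>u\<in>V. \<forall>v\<in>V. u \<noteq> v \<and> {u, v} \<notin> E \<longrightarrow>
        (\<forall>a\<in>P. \<exists>e\<in>E. (u \<in> e \<or> v \<in> e) \<and> c e = a))"
proof -
  have key: "proper_edge_coloring (insert {u, v} E) P (c({u, v} := a)) \<longleftrightarrow>
      (\<forall>e\<in>E. u \<in> e \<or> v \<in> e \<longrightarrow> c e \<noteq> a)"
    if c: "proper_edge_coloring E P c" and uv: "{u, v} \<notin> E" and a: "a \<in> P" for u v a
  proof
    assume new: "proper_edge_coloring (insert {u, v} E) P (c({u, v} := a))"
    show "\<forall>e\<in>E. u \<in> e \<or> v \<in> e \<longrightarrow> c e \<noteq> a"
    proof (intro ballI impI)
      fix e assume e: "e \<in> E" "u \<in> e \<or> v \<in> e"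
      then have ne: "e \<noteq> {u, v}" and int: "e \<inter> {u, v} \<noteq> {}" using uv by auto
      then have "(c({u, v} := a)) e \<noteq> (c({u, v} := a)) {u, v}"
        by (intro proper_edge_coloringD[OF new] ne int) (use e in auto)
      then show "c e \<noteq> a" using ne by simp
    qed
  next
    assume free: "\<forall>e\<in>E. u \<in> e \<or> v \<in> e \<longrightarrow> c e \<noteq> a"
    have old: "(c({u, v} := a)) e = c e" if "e \<in> E" for e using that uv by auto
    show "proper_edge_coloring (insert {u, v} E) P (c({u, v} := a))"
      unfolding proper_edge_coloring_def
    proof (intro conjI ballI impI)
      show "(c({u, v} := a)) ` insert {u, v} E \<subseteq> P"
        using c a unfolding proper_edge_coloring_def by auto
    next
      fix e f
      assume e: "e \<in> insert {u, v} E" and f: "f \<in> insert {u, v} E"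
        and ef: "e \<noteq> f \<and> e \<inter> f \<noteq> {}"
      consider "e = {u, v}" "f \<in> E" | "f = {u, v}" "e \<in> E" | "e \<in> E" "f \<in> E"
        using e f ef by blast
      then show "(c({u, v} := a)) e \<noteq> (c({u, v} := a)) f"
      proof cases
        case 1
        then have "c f \<noteq> a" using ef free by blast
        then show ?thesis using 1 old by simp
      next
        case 2
        then have "c e \<noteq> a" using ef free by blast
        then show ?thesis using 2 old by simp
      next
        case 3
        then have "c e \<noteq> c f" using ef proper_edge_coloringD[OF c] by blast
        then show ?thesis using 3 old by simp
      qed
    qed
  qed
  have nonedges: "(\<forall>e \<in> nsets V 2 - E. Q e) \<longleftrightarrow>
      (\<forall>u\<in>V. \<forall>v\<in>V. u \<noteq> v \<and> {u, v} \<notin> E \<longrightarrow> Q {u, v})" for Q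
    by (auto elim!: nsets2_E)
  show ?thesis
    unfolding maximal_edge_coloring_def nonedges by (simp add: key cong: conj_cong) blast
qed

text \<open>The standard value of the chromatic index of a complete graph of odd order.\<close>

lemma chromatic_index_complete_odd:
  assumes "odd n" "n \<ge> 3"
  shows "chromatic_index (complete_graph_edges n) = n"
  unfolding chromatic_index_def
proof (rule Least_equality)
  have "proper_edge_coloring (complete_graph_edges n) {..<n} (\<lambda>e. (\<Sum>x\<in>e. x) mod n)"
    unfolding proper_edge_coloring_def
  proof (intro conjI ballI impI)
    show "(\<lambda>e. (\<Sum>x\<in>e. x) mod n) ` complete_graph_edges n \<subseteq> {..<n}"
      using assms by auto
  next
    fix e f :: "nat set"
    assume ef: "e \<in> complete_graph_edges n" "f \<in> complete_graph_edges n" "e \<noteq> f \<and> e \<inter> f \<noteq> {}"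
    then obtain x where x: "x \<in> e" "x \<in> f" by blast
    obtain y where y: "e = {x, y}" "x \<noteq> y" "y < n"
      using ef(1) x(1) unfolding complete_graph_edges_def nsets_2_eq by auto
    obtain z where z: "f = {x, z}" "x \<noteq> z" "z < n"
      using ef(2) x(2) unfolding complete_graph_edges_def nsets_2_eq by auto
    have "y \<noteq> z" using y z ef by auto
    have "(x + y) mod n \<noteq> (x + z) mod n"
    proof
      assume "(x + y) mod n = (x + z) mod n"
      then have "int (x + y) mod int n = int (x + z) mod int n" by (metis of_nat_mod)
      then have "int n dvd int y - int z" by (simp add: mod_eq_dvd_iff)
      with \<open>y \<noteq> z\<close> have "int n \<le> \<bar>int y - int z\<bar>"
        using dvd_imp_le_int[of "int y - int z" "int n"] by simp
      then show False using y z by linarith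
    qed
    then show "(\<Sum>x\<in>e. x) mod n \<noteq> (\<Sum>x\<in>f. x) mod n" using y z by simp
  qed
  then show "\<exists>c. proper_edge_coloring (complete_graph_edges n) {..<n} c" by blast
next
  fix k :: nat assume "\<exists>c. proper_edge_coloring (complete_graph_edges n) {..<k} c"
  then obtain c where c: "proper_edge_coloring (complete_graph_edges n) {..<k} c" ..
  let ?E = "complete_graph_edges n"
  define M where "M a = {e \<in> ?E. c e = a}" for a
  have cardM: "card (M a) \<le> (n - 1) div 2" for a
  proof -
    have disj: "pairwise disjnt (M a)"
      using proper_edge_coloringD[OF c] unfolding M_def pairwise_def disjnt_def by blast
    have two: "card e = 2 \<and> finite e" if "e \<in> M a" for e
      using that unfolding M_def complete_graph_edges_def nsets_def by auto
    have "card (\<Union>(M a)) = (\<Sum>e\<in>M a. card e)"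
      by (rule card_Union_disjoint[OF disj]) (use two in blast)
    also have "\<dots> = 2 * card (M a)" using two by simp
    finally have "2 * card (M a) = card (\<Union>(M a))" ..
    also have "\<dots> \<le> card {..<n}"
      by (rule card_mono) (auto simp: M_def complete_graph_edges_def nsets_def)
    finally show ?thesis using assms(1) by (auto elim!: oddE)
  qed
  have "?E = (\<Union>a\<in>{..<k}. M a)"
    using c unfolding M_def proper_edge_coloring_def by auto
  then have "card ?E \<le> (\<Sum>a<k. card (M a))" by (metis card_UN_le finite_lessThan)
  also have "\<dots> \<le> k * ((n - 1) div 2)"
    using sum_bounded_above[of "{..<k}" "\<lambda>a. card (M a)" "(n - 1) div 2"] cardM by simp
  finally have "n choose 2 \<le> k * ((n - 1) div 2)"
    unfolding complete_graph_edges_def by simp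
  moreover have "n choose 2 = n * ((n - 1) div 2)"
    using assms(1) by (auto simp: choose_two elim!: oddE)
  ultimately show "n \<le> k" using assms by auto
qed

end

theory Submission
  imports Defs
begin

text \<open>Write \<open>n = 2k + 1\<close> and let \<open>d\<close> denote the degree in the complement \<open>H\<close> of \<open>G\<close>. A vertex \<open>v\<close> misses
  exactly \<open>d v + 1\<close> colors, and \<open>H\<close>-adjacent vertices miss disjoint sets of colors, so
  \<open>d u + d v \<le> 2k - 1\<close> on every edge of \<open>H\<close>. The claim is that \<open>H\<close> has at most \<open>k (k - 1)\<close> edges.

  If some edge \<open>uv\<close> of \<open>H\<close> attains equality, the colors missing at \<open>v\<close> and those missing at \<open>u\<close>
  partition the palette; the former saturate the \<open>H\<close>-neighborhood of \<open>v\<close> and the latter that of \<open>u\<close>,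
  which forces enough edges of \<open>G\<close> of either kind.

  Otherwise \<open>d u + d v \<le> 2k - 2\<close> on every edge of \<open>H\<close>. Since a color is missing at no more than one
  vertex of a triangle and two vertices of a pentagon of \<open>H\<close>, the degree sums over these are at most
  \<open>2k - 2\<close> and \<open>4k - 3\<close>. With more than \<open>k (k - 1)\<close> edges the degrees in and outside the neighborhood
  of a vertex of maximal degree are almost as large as possible, so that
  triangles and pentagons would violate these bounds; \<open>H\<close> is then essentially bipartite and has too
  few edges after all.\<close>

section \<open>Graphs with bounded degree sums on short odd cycles\<close>

text \<open>The graph \<open>H\<close> enters through its neighborhoods only, which keeps the degree
  argument apart from the coloring.\<close>

locale nbhd_graph =
  fixes V :: "'a set" and N :: "'a \<Rightarrow> 'a set"
  assumes finite_V: "finite V"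
    and N_subset: "N v \<subseteq> V"
    and N_irrefl: "v \<notin> N v"
    and N_sym: "u \<in> N v \<Longrightarrow> v \<in> N u"
begin

abbreviation d :: "'a \<Rightarrow> int" where "d v \<equiv> int (card (N v))"

lemma finite_N: "finite (N v)"
  using finite_subset[OF N_subset finite_V] .

text \<open>Both sides count the pairs of adjacent \<open>x \<in> S\<close> and
  \<open>y \<in> T\<close>; the two sets may overlap.\<close>

lemma handshake:
  assumes "S \<subseteq> V" "T \<subseteq> V"
  shows "(\<Sum>x\<in>S. int (card (N x \<inter> T))) = (\<Sum>x\<in>T. int (card (N x \<inter> S)))"
proof -
  have fin: "finite S" "finite T" using assms finite_V finite_subset by auto
  have "(\<Sum>x\<in>S. card {y\<in>T. y \<in> N x}) = (\<Sum>y\<in>T. card (N y \<inter> S))"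
  proof (rule sum_multicount_gen[OF fin], rule ballI)
    fix y assume "y \<in> T"
    have "{x\<in>S. y \<in> N x} = N y \<inter> S" using N_sym by blast
    then show "card {x\<in>S. y \<in> N x} = card (N y \<inter> S)" by simp
  qed
  moreover have "{y\<in>T. y \<in> N x} = N x \<inter> T" for x by blast
  ultimately have "(\<Sum>x\<in>S. card (N x \<inter> T)) = (\<Sum>y\<in>T. card (N y \<inter> S))" by simp
  then show ?thesis by (metis (no_types, lifting) of_nat_sum sum.cong)
qed

text \<open>Adjacency or non-adjacency to a vertex \<open>v\<close> of maximal degree bounds every
  degree from above, and \<open>g\<close> records by how much a vertex falls short. A degree sum
  above the claim leaves too little total slack \<open>G\<close> for a badly placed triangle or
  pentagon. The hypotheses speak of closed walks, so vertices of a pentagon may coincide.\<close>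

lemma degree_sum_bound:
  fixes k :: nat
  assumes card_V: "card V = 2 * k + 1" and k: "k \<ge> 4"
    and edge: "\<And>x y. y \<in> N x \<Longrightarrow> d x + d y \<le> 2 * int k - 2"
    and triangle: "\<And>x y z. y \<in> N x \<Longrightarrow> z \<in> N y \<Longrightarrow> x \<in> N z \<Longrightarrow> d x + d y + d z \<le> 2 * int k - 2"
    and pentagon: "\<And>x1 x2 x3 x4 x5. x2 \<in> N x1 \<Longrightarrow> x3 \<in> N x2 \<Longrightarrow> x4 \<in> N x3 \<Longrightarrow> x5 \<in> N x4 \<Longrightarrow>
        x1 \<in> N x5 \<Longrightarrow> d x1 + d x2 + d x3 + d x4 + d x5 \<le> 4 * int k - 3"
    and even: "even (\<Sum>x\<in>V. d x)"
  shows "(\<Sum>x\<in>V. d x) \<le> 2 * int k * (int k - 1)"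
proof (rule ccontr)

  \<comment> \<open>Slack of the degrees around a vertex of maximal degree\<close>
  define K where "K = int k"
  have K: "K \<ge> 4" using k K_def by simp
  have cV: "int (card V) = 2 * K + 1" using card_V K_def by simp
  assume "\<not> ?thesis"
  then have "(\<Sum>x\<in>V. d x) > 2 * (K * (K - 1))" unfolding K_def by (simp add: algebra_simps)
  then have big: "(\<Sum>x\<in>V. d x) \<ge> 2 * (K * (K - 1)) + 2" using even by presburger
  have "V \<noteq> {}" using card_V by auto
  then obtain v where v: "v \<in> V" and vmax: "\<And>x. x \<in> V \<Longrightarrow> d x \<le> d v"
  proof -
    have "Max (d ` V) \<in> d ` V" using finite_V \<open>V \<noteq> {}\<close> by (intro Max_in) auto
    then obtain v where "v \<in> V" "d v = Max (d ` V)" by auto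
    then show ?thesis using that finite_V by (metis Max_ge finite_imageI imageI)
  qed
  define t where "t = d v - (K - 1)"
  have dv: "d v = K - 1 + t" unfolding t_def by simp
  have t0: "t \<ge> 0"
  proof (rule ccontr)
    assume "\<not> t \<ge> 0"
    then have "d x \<le> K - 2" if "x \<in> V" for x using vmax[OF that] dv by linarith
    then have "(\<Sum>x\<in>V. d x) \<le> int (card V) * (K - 2)" by (rule sum_bounded_above)
    also have "\<dots> = 2 * (K * (K - 1)) - K - 2" using cV by (simp add: algebra_simps)
    finally show False using big K by linarith
  qed
  have tt: "t * t \<ge> t" using t0 by (cases "t = 0") (auto intro: mult_left_mono[of 1 t t, simplified])
  define A where "A = N v"
  define Z where "Z = V - A"
  have AV: "A \<subseteq> V" and ZV: "Z \<subseteq> V" using N_subset A_def Z_def by auto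
  have fin: "finite A" "finite Z" using AV ZV finite_V finite_subset by auto
  have cA: "int (card A) = K - 1 + t" using dv A_def by simp
  have cZ: "int (card Z) = K + 2 - t"
  proof -
    have "card Z = card V - card A" unfolding Z_def by (rule card_Diff_subset[OF fin(1) AV])
    moreover have "card A \<le> card V" using AV finite_V card_mono by blast
    ultimately show ?thesis using cV cA by simp
  qed
  have vZ: "v \<in> Z" using v N_irrefl A_def Z_def by auto
  have split: "sum f V = sum f A + sum f Z" for f :: "'a \<Rightarrow> int"
    using sum.subset_diff[OF AV finite_V] Z_def by (simp add: add.commute)
  \<comment> \<open>By \<open>edge\<close> applied to \<open>v\<close>, a vertex of \<open>A\<close>
    has degree at most \<open>2 * K - 2 - d v\<close>, which is \<open>K - 1 - t\<close>; all others
    have degree at most \<open>d v\<close>.\<close>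
  define g where "g x = (if x \<in> A then K - 1 - t else K - 1 + t) - d x" for x
  have dA: "d x = K - 1 - t - g x" if "x \<in> A" for x using that g_def by simp
  have dZ: "d x = K - 1 + t - g x" if "x \<in> Z" for x using that g_def Z_def by simp
  have g0: "g x \<ge> 0" if "x \<in> V" for x
  proof (cases "x \<in> A")
    case True
    then have "d v + d x \<le> 2 * K - 2" using edge A_def K_def by simp
    then show ?thesis using True dv g_def by simp
  next
    case False
    then show ?thesis using vmax[OF that] dv g_def by simp
  qed
  have sumA: "sum d A = (K - 1 + t) * (K - 1 - t) - sum g A"
  proof -
    have "sum d A = (\<Sum>x\<in>A. (K - 1 - t) - g x)" by (rule sum.cong) (auto simp: dA)
    then show ?thesis by (simp add: sum_subtractf cA)
  qed
  have sumZ': "sum d S = int (card S) * (K - 1 + t) - sum g S" if "S \<subseteq> Z" for S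
  proof -
    have "sum d S = (\<Sum>x\<in>S. (K - 1 + t) - g x)" using that by (intro sum.cong) (auto simp: dZ)
    then show ?thesis by (simp add: sum_subtractf)
  qed
  define G where "G = sum g V"
  \<comment> \<open>Without slack the degree sum would be
    \<open>2 * (K * (K - 1)) + K - 1 + 3 * t - 2 * (t * t)\<close>, and by parity it exceeds the
    claim by at least 2. With \<open>tt\<close> the bound gives \<open>G \<le> K - 3 + t\<close>,
    which most contradictions below rest on.\<close>
  have G: "G \<le> K - 3 + 3 * t - 2 * (t * t)"
  proof -
    have "sum d V = (K - 1 + t) * (K - 1 - t) + (K + 2 - t) * (K - 1 + t) - G"
      using split[of d] split[of g] sumA sumZ'[OF order_refl] cZ G_def by simp
    also have "\<dots> = 2 * (K * (K - 1)) + K - 1 + 3 * t - 2 * (t * t) - G"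
      by (simp add: algebra_simps)
    finally show ?thesis using big by linarith
  qed
  have inV: "x \<in> V" if "x \<in> A \<or> x \<in> Z" for x using that AV ZV by auto
  have sub: "sum g S \<le> G" if "S \<subseteq> V" for S
    unfolding G_def using that finite_V g0 by (intro sum_mono2) auto

  \<comment> \<open>Edges outside the neighborhood of \<open>v\<close>\<close>
  have Zedge: False if "z \<in> Z" "z' \<in> Z" "z' \<in> N z" "x \<in> N z \<inter> A" "x' \<in> N z' \<inter> A" for z z' x x'
  proof (cases "x = x'")
    case True
    \<comment> \<open>The triangle \<open>z\<close>, \<open>z'\<close>, \<open>x\<close> takes slack
      at least \<open>K - 1 + t\<close>.\<close>
    have "d z + d z' + d x \<le> 2 * K - 2"
      unfolding K_def using that True N_sym by (intro triangle) auto
    moreover have "g z + g z' + g x \<le> G"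
    proof -
      have "z \<noteq> z'" "z \<noteq> x" "z' \<noteq> x" using that N_irrefl Z_def by auto
      then show ?thesis using sub[of "{z, z', x}"] that by (simp add: inV)
    qed
    ultimately show False using dZ[of z] dZ[of z'] dA[of x] that G tt by simp
  next
    case False
    \<comment> \<open>The pentagon \<open>v\<close>, \<open>x\<close>, \<open>z\<close>,
      \<open>z'\<close>, \<open>x'\<close> takes slack at least \<open>K - 2 + t\<close>.\<close>
    have "d v + d x + d z + d z' + d x' \<le> 4 * K - 3"
      unfolding K_def using that N_sym A_def by (intro pentagon) auto
    moreover have "g x + g z + g z' + g x' \<le> G"
    proof -
      have "z \<noteq> z'" "z \<noteq> x" "z' \<noteq> x" "z \<noteq> x'" "z' \<noteq> x'" using that N_irrefl Z_def by auto
      then show ?thesis using sub[of "{x, z, z', x'}"] that False by (auto simp: inV)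
    qed
    ultimately show False using dZ[of z] dZ[of z'] dA[of x] dA[of x'] that G tt dv by simp
  qed
  define Z0 where "Z0 = {z \<in> Z. N z \<inter> A = {}}"
  define Z1 where "Z1 = Z - Z0"
  have Z0Z: "Z0 \<subseteq> Z" and Z1Z: "Z1 \<subseteq> Z" unfolding Z0_def Z1_def by auto
  have fin0: "finite Z0" "finite Z1" using Z0Z Z1Z fin finite_subset by auto
  have "A \<noteq> {}" using cA K t0 by auto
  then have vZ1: "v \<in> Z1" using vZ A_def Z0_def Z1_def by auto
  have Z1_indep: "N z \<inter> Z1 = {}" if "z \<in> Z1" for z
    using that Zedge[of z] unfolding Z1_def Z0_def by blast
  have NZ0: "N z \<subseteq> Z - {v, z}" if "z \<in> Z0" for z
    using that N_irrefl[of z] N_subset[of z] N_sym[of v z] unfolding Z0_def Z_def A_def by auto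

  \<comment> \<open>Independence of the neighborhood of \<open>v\<close>\<close>
  have A_indep: "N x \<inter> A = {}" if xA: "x \<in> A" for x
  proof (rule ccontr)
    assume "N x \<inter> A \<noteq> {}"
    then obtain x' where x': "x' \<in> N x" "x' \<in> A" by blast
    then have "x \<noteq> x'" using N_irrefl by auto
    have "d v + d x + d x' \<le> 2 * K - 2"
      unfolding K_def using xA x' N_sym A_def by (intro triangle) auto
    then have gg: "g x + g x' \<ge> K - 1 - t" using dv dA xA x' by simp
    have "g x + g x' \<le> G" using sub[of "{x, x'}"] xA x' AV \<open>x \<noteq> x'\<close> by auto
    \<comment> \<open>The triangle \<open>v\<close>, \<open>x\<close>, \<open>x'\<close> fits into
      the available slack for \<open>t = 1\<close> only, and then \<open>x\<close> and
      \<open>x'\<close> use up all of it.\<close>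
    then have "2 * ((t - 1) * (t - 1)) \<le> 0" using gg G by (simp add: algebra_simps)
    then have "(t - 1)\<^sup>2 \<le> 0" by (simp add: power2_eq_square)
    then have t1: "t = 1" by simp
    have gZ: "g z = 0" if "z \<in> Z" for z
    proof -
      have "z \<noteq> x" "z \<noteq> x'" using that xA x' Z_def by auto
      then have "g x + g x' + g z \<le> G"
        using sub[of "{x, x', z}"] xA x' that \<open>x \<noteq> x'\<close> by (auto simp: inV)
      then show ?thesis using gg G t1 g0[of z] that ZV by auto
    qed
    have NzA: "N z \<subseteq> A" if zZ: "z \<in> Z" for z
    proof (rule ccontr)
      \<comment> \<open>A vertex of \<open>Z0\<close> has at most \<open>card Z - 2\<close>
        neighbors, that is \<open>K - 1\<close>, whereas zero slack requires degree
        \<open>K\<close>.\<close>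
      have Z0e: "Z0 = {}"
      proof (rule ccontr)
        assume "Z0 \<noteq> {}"
        then obtain y where y: "y \<in> Z0" by blast
        have "card (N y) \<le> card (Z - {v, y})" using NZ0[OF y] fin by (intro card_mono) auto
        also have "\<dots> = card Z - card {v, y}"
          using vZ y Z0Z by (intro card_Diff_subset) auto
        also have "card {v, y} = 2" using vZ1 y Z1_def by (cases "v = y") auto
        finally have "card (N y) \<le> card Z - 2" .
        then have "d y \<le> K - 1" using cZ t1 K by linarith
        then show False using dZ[of y] gZ[of y] y Z0Z t1 by auto
      qed
      assume "\<not> N z \<subseteq> A"
      then show False using Z1_indep[of z] zZ N_subset[of z] Z0e unfolding Z1_def Z_def by auto
    qed
    \<comment> \<open>All edges at \<open>Z\<close> now lead to \<open>A\<close>, but the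
      \<open>K + 1\<close> vertices of \<open>Z\<close> have degree \<open>K\<close>, more than
      \<open>A\<close> can absorb.\<close>
    have "sum d Z = (\<Sum>z\<in>Z. int (card (N z \<inter> A)))"
      using NzA by (intro sum.cong) (auto simp: Int_absorb2)
    also have "\<dots> = (\<Sum>x\<in>A. int (card (N x \<inter> Z)))" by (rule handshake[OF ZV AV])
    also have "\<dots> \<le> sum d A" using finite_N by (intro sum_mono) (simp add: card_mono)
    finally have "sum d Z \<le> sum d A" .
    moreover have "sum g A \<ge> 0" using g0 AV by (intro sum_nonneg) auto
    moreover have "sum g Z = 0" using gZ by simp
    ultimately have "(K + 1) * K \<le> K * (K - 2)"
      using sumA sumZ'[OF order_refl] cZ t1 by (simp add: algebra_simps)
    then show False using K by (simp add: algebra_simps)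
  qed

  \<comment> \<open>Edge counts in terms of \<open>Z0\<close>\<close>
  define q where "q = int (card Z0)"
  have cZ1: "int (card Z1) = K + 2 - t - q"
  proof -
    have "card Z1 = card Z - card Z0" unfolding Z1_def by (rule card_Diff_subset[OF fin0(1) Z0Z])
    moreover have "card Z0 \<le> card Z" using Z0Z fin card_mono by blast
    ultimately show ?thesis using cZ q_def by simp
  qed
  have NA: "N x \<subseteq> Z1" if "x \<in> A" for x
    using A_indep[OF that] N_subset[of x] N_sym[of _ x] that unfolding Z1_def Z0_def Z_def by blast
  have q3: "q \<le> 3"
  proof (rule ccontr)
    assume "\<not> q \<le> 3"
    \<comment> \<open>For \<open>q \<ge> 4\<close> the set \<open>Z1\<close>, which contains all
      neighbors of \<open>x\<close>, is so small that each of the \<open>K - 1 + t\<close> vertices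
      of \<open>A\<close> has slack.\<close>
    have "g x \<ge> 1" if "x \<in> A" for x
    proof -
      have "d x \<le> int (card Z1)" using NA[OF that] fin0 card_mono by simp
      then show ?thesis using cZ1 dA[OF that] \<open>\<not> q \<le> 3\<close> by linarith
    qed
    then have "int (card A) * 1 \<le> sum g A" by (intro sum_bounded_below) auto
    then show False using cA sub[OF AV] G tt by linarith
  qed
  \<comment> \<open>Twice the number of edges inside \<open>Z0\<close>.\<close>
  define e2 where "e2 = (\<Sum>z\<in>Z0. int (card (N z \<inter> Z0)))"
  have "e2 \<ge> 0" unfolding e2_def by (intro sum_nonneg) auto
  have splitZ: "sum f Z = sum f Z0 + sum f Z1" for f :: "'a \<Rightarrow> int"
    using sum.subset_diff[OF Z0Z fin(2)] Z1_def by (simp add: add.commute)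
  \<comment> \<open>Edges at \<open>A\<close> lead to \<open>Z1\<close>, and edges at
    \<open>Z1\<close> lead to \<open>A\<close> or \<open>Z0\<close>, so both \<open>A\<close> and
    \<open>Z0\<close> are counted through \<open>Z1\<close>.\<close>
  have sAZ: "sum d A = sum d Z1 - sum d Z0 + e2"
  proof -
    have Z0V: "Z0 \<subseteq> V" and Z1V: "Z1 \<subseteq> V" using Z0Z Z1Z ZV by auto
    have "sum d A = (\<Sum>x\<in>A. int (card (N x \<inter> Z1)))"
      using NA by (intro sum.cong) (auto simp: Int_absorb2)
    also have "\<dots> = (\<Sum>z\<in>Z1. int (card (N z \<inter> A)))" by (rule handshake[OF AV Z1V])
    also have "\<dots> = (\<Sum>z\<in>Z1. d z - int (card (N z \<inter> Z0)))"
    proof (rule sum.cong)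
      fix z assume z: "z \<in> Z1"
      have "N z = (N z \<inter> A) \<union> (N z \<inter> Z0)"
        using Z1_indep[OF z] N_subset[of z] unfolding Z1_def Z_def by blast
      moreover have "(N z \<inter> A) \<inter> (N z \<inter> Z0) = {}" using Z0Z Z_def by auto
      ultimately have "card (N z) = card (N z \<inter> A) + card (N z \<inter> Z0)"
        using card_Un_disjoint[of "N z \<inter> A" "N z \<inter> Z0"] finite_N by simp
      then show "int (card (N z \<inter> A)) = d z - int (card (N z \<inter> Z0))" by simp
    qed simp
    also have "\<dots> = sum d Z1 - (\<Sum>z\<in>Z0. int (card (N z \<inter> Z1)))"
      by (simp add: sum_subtractf handshake[OF Z1V Z0V])
    also have "(\<Sum>z\<in>Z0. int (card (N z \<inter> Z1))) = (\<Sum>z\<in>Z0. d z - int (card (N z \<inter> Z0)))"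
    proof (rule sum.cong)
      fix z assume z: "z \<in> Z0"
      have "N z = (N z \<inter> Z1) \<union> (N z \<inter> Z0)" using NZ0[OF z] unfolding Z1_def by blast
      moreover have "(N z \<inter> Z1) \<inter> (N z \<inter> Z0) = {}" using Z1_def by auto
      ultimately have "card (N z) = card (N z \<inter> Z1) + card (N z \<inter> Z0)"
        using card_Un_disjoint[of "N z \<inter> Z1" "N z \<inter> Z0"] finite_N by simp
      then show "int (card (N z \<inter> Z1)) = d z - int (card (N z \<inter> Z0))" by simp
    qed simp
    finally show ?thesis unfolding e2_def by (simp add: sum_subtractf)
  qed
  \<comment> \<open>Every edge meets \<open>A\<close> or \<open>Z0\<close>, and only the edges
    inside \<open>Z0\<close> have both ends in their union.\<close>
  have total: "sum d V = 2 * (sum d A + sum d Z0) - e2"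
    unfolding split[of d] splitZ[of d] using sAZ by (simp add: algebra_simps)
  have gA0: "sum g A \<ge> 0" and gZ00: "sum g Z0 \<ge> 0" and gZ10: "sum g Z1 \<ge> 0"
    using g0 AV ZV Z0Z Z1Z by (auto intro!: sum_nonneg)
  have Gsplit: "G = sum g A + sum g Z0 + sum g Z1"
    using split[of g] splitZ[of g] G_def by simp
  have dZle: "d z \<le> K - 1 + t" if "z \<in> V" for z using vmax[OF that] dv by simp
  text \<open>This excludes that \<open>A\<close> together with one further vertex, of degree \<open>y\<close>, meets every edge.\<close>
  have cover: False if "sum d V \<le> 2 * (sum d A + y)" "y \<le> K - 1 + t" for y
  proof -
    have "sum d V \<le> 2 * ((K - 1 + t) * (K - 1 - t) + (K - 1 + t))"
      using that sumA gA0 by (simp add: algebra_simps)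
    also have "\<dots> = 2 * (K * (K - 1)) - 2 * (t * t) + 2 * t" by (simp add: algebra_simps)
    finally show False using big tt by linarith
  qed
  have key: "(K - 1 + t) * (2 * q - 3) = sum g A - sum g Z1 + sum g Z0 + e2"
  proof -
    have "(K - 1 + t) * (K - 1 - t) - sum g A =
        (K + 2 - t - q) * (K - 1 + t) - sum g Z1 - (q * (K - 1 + t) - sum g Z0) + e2"
      using sAZ sumA sumZ'[OF Z1Z] sumZ'[OF Z0Z] cZ1 q_def by simp
    then show ?thesis by (simp add: algebra_simps)
  qed
  have e2le: "e2 \<le> q * (q - 1)"
  proof -
    have "int (card (N z \<inter> Z0)) \<le> q - 1" if "z \<in> Z0" for z
    proof -
      have "card (N z \<inter> Z0) \<le> card (Z0 - {z})"
        using N_irrefl[of z] fin0 by (intro card_mono) auto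
      also have "card (Z0 - {z}) = card Z0 - 1" using that fin0 by simp
      finally have "card (N z \<inter> Z0) \<le> card Z0 - 1" .
      moreover have "card Z0 > 0" using that fin0 card_gt_0_iff by blast
      ultimately show ?thesis unfolding q_def by linarith
    qed
    then show ?thesis unfolding e2_def q_def by (rule sum_bounded_above)
  qed

  \<comment> \<open>The cases of at most one, three and two vertices in \<open>Z0\<close>\<close>
  have "q \<ge> 0" unfolding q_def by simp
  then consider "q = 0 \<or> q = 1" | "q = 2" | "q = 3" using q3 by linarith
  then show False
  proof cases
    case 1
    have "sum d Z0 \<le> int (card Z0) * (K - 1 + t)"
      using dZle Z0Z ZV by (intro sum_bounded_above) auto
    then have "sum d Z0 \<le> K - 1 + t" using 1 q_def K t0 by auto
    then show False using cover[of "sum d Z0"] total \<open>e2 \<ge> 0\<close> by simp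
  next
    case 3
    \<comment> \<open>Here \<open>e2 \<le> 6\<close>; together with the bound on \<open>G\<close>
      this would force \<open>K \<le> 3\<close>.\<close>
    then have "3 * K - 3 + 3 * t \<le> G + 6" using key e2le Gsplit gZ10 by simp
    moreover have "t * t \<ge> 0" by simp
    ultimately show False using G K by linarith
  next
    case 2
    then have "card Z0 = 2" using q_def by simp
    then obtain z z' where zz: "Z0 = {z, z'}" "z \<noteq> z'" by (meson card_2_iff)
    have e22: "e2 = 2" and zadj: "z' \<in> N z"
    proof -
      have "z' \<in> N z"
      proof (rule ccontr)
        assume "z' \<notin> N z"
        moreover then have "z \<notin> N z'" using N_sym by blast
        ultimately have "N z \<inter> Z0 = {}" "N z' \<inter> Z0 = {}" using N_irrefl zz by auto
        then have "e2 = 0" unfolding e2_def zz by (simp add: zz(2))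
        then have "K - 1 + t \<le> G" using key 2 Gsplit gZ10 by simp
        then show False using G tt by linarith
      qed
      moreover then have "z \<in> N z'" using N_sym by blast
      ultimately have "N z \<inter> Z0 = {z'}" "N z' \<inter> Z0 = {z}" using N_irrefl zz by auto
      then show "e2 = 2" unfolding e2_def zz by (simp add: zz(2))
      show "z' \<in> N z" by fact
    qed
    have zadj': "z \<in> N z'" using zadj N_sym by blast
    have zZ: "z \<in> Z" "z' \<in> Z" using zz Z0Z by auto
    have N1: "N z = insert z' (N z \<inter> Z1)" "N z' = insert z (N z' \<inter> Z1)"
      using NZ0[of z] NZ0[of z'] zadj zadj' zz N_irrefl unfolding Z1_def by auto
    have nz: "z \<notin> Z1" "z' \<notin> Z1" using zz Z1_def by auto
    have dz: "d z = 1 + int (card (N z \<inter> Z1))" "d z' = 1 + int (card (N z' \<inter> Z1))"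
      using N1 nz finite_N by (metis IntD2 card_insert_disjoint finite_Int of_nat_Suc)+
    have sumZ0: "sum d Z0 = d z + d z'" "sum g Z0 = g z + g z'" using zz by auto
    have dmax: "d z \<le> K - 1 + t" "d z' \<le> K - 1 + t" using dZle zZ ZV by auto
    \<comment> \<open>Otherwise \<open>z'\<close> is the only neighbor of \<open>z\<close>, so
      \<open>A\<close> and \<open>z'\<close> meet every edge.\<close>
    have "N z \<inter> Z1 \<noteq> {}"
    proof
      assume "N z \<inter> Z1 = {}"
      then show False using cover[of "d z'"] dz total sumZ0 e22 dmax by simp
    qed
    then obtain w where w: "w \<in> N z" "w \<in> Z1" by blast
    have "N z' \<inter> Z1 \<noteq> {}"
    proof
      assume "N z' \<inter> Z1 = {}"
      then show False using cover[of "d z"] dz total sumZ0 e22 dmax by simp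
    qed
    then obtain w' where w': "w' \<in> N z'" "w' \<in> Z1" by blast
    have disj: "N z \<inter> N z' = {}"
    proof (rule ccontr)
      assume "N z \<inter> N z' \<noteq> {}"
      then obtain y where y: "y \<in> N z" "y \<in> N z'" by blast
      have yZ: "y \<in> Z" using NZ0[of z] y zz by auto
      \<comment> \<open>A triangle inside \<open>Z\<close> takes slack at least
        \<open>K - 1 + 3 * t\<close>.\<close>
      have "d z + d z' + d y \<le> 2 * K - 2"
        unfolding K_def using y zadj N_sym by (intro triangle) auto
      moreover have "g z + g z' + g y \<le> G"
      proof -
        have "y \<noteq> z" "y \<noteq> z'" using y N_irrefl by auto
        then show ?thesis using sub[of "{z, z', y}"] zZ yZ zz(2) by (auto simp: inV)
      qed
      ultimately show False using dZ zZ yZ G tt t0 by simp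
    qed
    have "card (N z \<inter> Z1) + card (N z' \<inter> Z1) = card ((N z \<inter> Z1) \<union> (N z' \<inter> Z1))"
      using disj fin0 by (intro card_Un_disjoint[symmetric]) auto
    also have "\<dots> \<le> card (Z1 - {v})"
      using NZ0[of z] NZ0[of z'] zz fin0 by (intro card_mono) auto
    also have "\<dots> = card Z1 - 1" using vZ1 fin0 by simp
    finally have "card (N z \<inter> Z1) + card (N z' \<inter> Z1) \<le> card Z1 - 1" .
    moreover have "card Z1 > 0" using vZ1 fin0 card_gt_0_iff by blast
    \<comment> \<open>The neighborhoods of \<open>z\<close> and \<open>z'\<close> in
      \<open>Z1\<close> are disjoint and avoid \<open>v\<close>; the edge between \<open>z\<close>
      and \<open>z'\<close> adds 2. The resulting slack at \<open>z\<close> and \<open>z'\<close>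
      exhausts \<open>G\<close> and forces \<open>t = 0\<close>.\<close>
    ultimately have dd: "d z + d z' \<le> K + 1 - t" using dz cZ1 2 by linarith
    then have gg: "g z + g z' \<ge> K - 3 + 3 * t" using dZ zZ by simp
    have "g z + g z' \<le> G" using Gsplit gA0 gZ10 sumZ0 by linarith
    then have "t * t \<le> 0" using gg G by linarith
    then have t0': "t = 0" using tt t0 by linarith
    have dw: "d y = K - 1" if "y \<in> Z1" for y
    proof -
      have "g y \<le> sum g Z1" using that g0 Z1Z ZV fin0 by (intro member_le_sum) auto
      then have "g y \<le> 0" using Gsplit gA0 gg G sumZ0 t0' by simp
      then have "g y = 0" using g0[of y] that Z1Z ZV by auto
      then show ?thesis using dZ[of y] that Z1Z t0' by auto
    qed
    have nA: "int (card (N y \<inter> A)) \<ge> K - 2" if y: "y \<in> Z1" for y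
    proof -
      have "N y \<subseteq> (N y \<inter> A) \<union> {z, z'}"
        using Z1_indep[OF y] N_subset[of y] zz unfolding Z1_def Z_def by auto
      moreover have "\<not> (z \<in> N y \<and> z' \<in> N y)" using disj N_sym by blast
      ultimately obtain s where "N y \<subseteq> insert s (N y \<inter> A)" by blast
      then have "card (N y) \<le> card (insert s (N y \<inter> A))" using fin by (intro card_mono) auto
      also have "\<dots> \<le> Suc (card (N y \<inter> A))" using fin by (simp add: card_insert_if)
      finally have "card (N y) \<le> Suc (card (N y \<inter> A))" .
      then show ?thesis using dw[OF y] by linarith
    qed
    \<comment> \<open>Two subsets of \<open>A\<close> of size at least \<open>K - 2\<close> must
      meet, since \<open>card A\<close> is \<open>K - 1\<close> and
      \<open>K \<ge> 4\<close>.\<close>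
    have "(N w \<inter> A) \<inter> (N w' \<inter> A) \<noteq> {}"
    proof
      assume "(N w \<inter> A) \<inter> (N w' \<inter> A) = {}"
      then have "card (N w \<inter> A) + card (N w' \<inter> A) = card ((N w \<inter> A) \<union> (N w' \<inter> A))"
        using fin by (intro card_Un_disjoint[symmetric]) auto
      also have "\<dots> \<le> card A" using fin by (intro card_mono) auto
      finally show False using nA[of w] nA[of w'] w w' cA t0' K by linarith
    qed
    then obtain x where x: "x \<in> N w" "x \<in> N w'" "x \<in> A" by blast
    \<comment> \<open>On this pentagon \<open>w\<close>, \<open>x\<close> and \<open>w'\<close> have
      degree \<open>K - 1\<close> and \<open>d z + d z' \<ge> K + 1\<close>, which adds up to at
      least \<open>4 * K - 2\<close>.\<close>
    have "d z + d w + d x + d w' + d z' \<le> 4 * K - 3"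
      unfolding K_def using w w' x zadj' zadj N_sym by (intro pentagon) auto
    moreover have "g x = 0"
    proof -
      have "g x \<le> sum g A" using x g0 AV fin by (intro member_le_sum) auto
      then have "g x \<le> 0" using Gsplit gZ10 gg G sumZ0 t0' by simp
      then show ?thesis using g0[of x] x AV by auto
    qed
    moreover have "g z + g z' \<le> K - 3" using \<open>g z + g z' \<le> G\<close> G t0' by simp
    ultimately show False using dw[of w] dw[of w'] w w' dA[of x] x dZ[of z] dZ[of z'] zZ t0' by simp
  qed
qed

end

section \<open>Counting the edges whose colors are missing at one vertex\<close>

text \<open>There are \<open>card A * (card A + 1)\<close> incidences between \<open>A\<close> and
  the edges colored from \<open>Y\<close>, and only edges inside \<open>A\<close>, at most
  \<open>card A choose 2\<close> of them, are counted twice. For the last claim, each color class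
  covers \<open>A\<close> and also leaves it, so an even \<open>card A\<close> forces at least one
  edge more than \<open>card A div 2\<close>.\<close>

lemma card_edges_with_colors:
  assumes E: "finite E" "E \<subseteq> nsets V 2" and c: "proper_edge_coloring E P c"
    and A: "finite A" and Y: "finite Y" "card Y = card A + 1"
    and seen: "\<forall>a\<in>A. \<forall>y\<in>Y. \<exists>e\<in>E. a \<in> e \<and> c e = y"
  shows "card A * (card A + 3) \<le> 2 * card {e\<in>E. c e \<in> Y}"
    and "2 * card {e\<in>E. c e \<in> Y} \<le> card A * (card A + 3) \<Longrightarrow> e \<in> E \<Longrightarrow> c e \<in> Y \<Longrightarrow> e \<inter> A \<noteq> {}"
    and "even (card A) \<Longrightarrow> (\<And>y. y \<in> Y \<Longrightarrow> \<exists>e\<in>E. c e = y \<and> card (e \<inter> A) = 1) \<Longrightarrow>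
      (card A + 1) * (card A + 2) \<le> 2 * card {e\<in>E. c e \<in> Y}"
proof -
  have card_e: "finite e \<and> card e = 2" if "e \<in> E" for e
    using that E unfolding nsets_def by auto
  have unique: "e = f" if "e \<in> E" "f \<in> E" "a \<in> e" "a \<in> f" "c e = c f" for a e f
    using proper_edge_coloringD[OF c that(1,2)] that by blast
  have count: "(\<Sum>e\<in>{e\<in>E. c e \<in> S}. card (e \<inter> A)) = card A * card S" if S: "S \<subseteq> Y" for S
  proof -
    have "(\<Sum>e\<in>{e\<in>E. c e \<in> S}. card {a\<in>A. a \<in> e}) = (\<Sum>a\<in>A. card S)"
    proof (rule sum_multicount_gen, goal_cases)
      case 3
      show ?case
      proof
        fix a assume a: "a \<in> A"
        have "bij_betw c {e \<in> {e\<in>E. c e \<in> S}. a \<in> e} S"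
          unfolding bij_betw_def
        proof
          show "inj_on c {e \<in> {e\<in>E. c e \<in> S}. a \<in> e}" using unique by (auto intro!: inj_onI)
          show "c ` {e \<in> {e\<in>E. c e \<in> S}. a \<in> e} = S" using seen a S by fastforce
        qed
        then show "card {e \<in> {e\<in>E. c e \<in> S}. a \<in> e} = card S" by (rule bij_betw_same_card)
      qed
    qed (use E A in auto)
    moreover have "{a\<in>A. a \<in> e} = e \<inter> A" for e by blast
    ultimately show ?thesis by simp
  qed
  let ?EY = "{e\<in>E. c e \<in> Y}"
  have meet: "card A * (card A + 3) \<le> 2 * card {e\<in>?EY. e \<inter> A \<noteq> {}}"
  proof -
    have "card A * (card A + 1) = (\<Sum>e\<in>?EY. card (e \<inter> A))" using count[of Y] Y by simp
    also have "\<dots> \<le> (\<Sum>e\<in>?EY. (if e \<inter> A \<noteq> {} then 1 else 0) + (if e \<subseteq> A then 1 else 0))"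
    proof (rule sum_mono)
      fix e assume "e \<in> ?EY"
      then have e: "finite e" "card e = 2" using card_e by auto
      show "card (e \<inter> A) \<le> (if e \<inter> A \<noteq> {} then 1 else 0) + (if e \<subseteq> A then 1 else 0)"
      proof (cases "e \<subseteq> A")
        case True
        then have "e \<inter> A = e" "e \<noteq> {}" using e by auto
        then show ?thesis using True e by simp
      next
        case False
        then have "card (e \<inter> A) < card e" using e by (intro psubset_card_mono) auto
        then show ?thesis using False e by auto
      qed
    qed
    also have "\<dots> = card {e\<in>?EY. e \<inter> A \<noteq> {}} + card {e\<in>?EY. e \<subseteq> A}"
      using E by (simp add: sum.distrib sum.If_cases Int_def)
    also have "card {e\<in>?EY. e \<subseteq> A} \<le> card (nsets A 2)"
      using A card_e by (intro card_mono finite_imp_finite_nsets) (auto simp: nsets_def)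
    finally have "card A * (card A + 1) \<le> card {e\<in>?EY. e \<inter> A \<noteq> {}} + card A * (card A - 1) div 2"
      by (simp add: choose_two)
    moreover have "2 * (card A * (card A - 1) div 2) \<le> card A * (card A - 1)" by simp
    moreover have "card A * (card A - 1) + 2 * card A = card A * (card A + 1)"
      by (cases "card A") auto
    moreover have "card A * (card A + 3) = card A * (card A + 1) + 2 * card A"
      by (simp add: algebra_simps)
    ultimately show ?thesis by linarith
  qed
  have sub: "card {e\<in>?EY. e \<inter> A \<noteq> {}} \<le> card ?EY" using E by (intro card_mono) auto
  show "card A * (card A + 3) \<le> 2 * card ?EY" using meet sub by linarith
  show "e \<inter> A \<noteq> {}" if "2 * card ?EY \<le> card A * (card A + 3)" "e \<in> E" "c e \<in> Y" for e
  proof -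
    have "card {e\<in>?EY. e \<inter> A \<noteq> {}} = card ?EY" using meet sub that by linarith
    then have "{e\<in>?EY. e \<inter> A \<noteq> {}} = ?EY" using E by (intro card_subset_eq) auto
    then show ?thesis using that by blast
  qed
  show "(card A + 1) * (card A + 2) \<le> 2 * card ?EY"
    if ev: "even (card A)" and one: "\<And>y. y \<in> Y \<Longrightarrow> \<exists>e\<in>E. c e = y \<and> card (e \<inter> A) = 1"
  proof -
    have each: "card A + 2 \<le> 2 * card {e\<in>E. c e = y}" if y: "y \<in> Y" for y
    proof -
      let ?M = "{e\<in>E. c e = y}"
      obtain e0 where e0: "e0 \<in> ?M" "card (e0 \<inter> A) = 1" using one[OF y] by auto
      have "card A = (\<Sum>e\<in>?M. card (e \<inter> A))" using count[of "{y}"] y by simp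
      also have "\<dots> < (\<Sum>e\<in>?M. 2)"
      proof (rule sum_strict_mono_ex1)
        show "\<forall>e\<in>?M. card (e \<inter> A) \<le> 2" using card_e by (metis (no_types, lifting) card_mono inf_le1 mem_Collect_eq)
        show "\<exists>e\<in>?M. card (e \<inter> A) < 2" using e0 by auto
      qed (use E in auto)
      finally have "card A < 2 * card ?M" by simp
      then show ?thesis using ev by presburger
    qed
    have "?EY = (\<Union>y\<in>Y. {e\<in>E. c e = y})" by auto
    then have "card ?EY = (\<Sum>y\<in>Y. card {e\<in>E. c e = y})"
      using E Y by (simp add: card_UN_disjoint disjoint_iff)
    then have "2 * card ?EY = (\<Sum>y\<in>Y. 2 * card {e\<in>E. c e = y})" by (simp add: sum_distrib_left)
    also have "\<dots> \<ge> card Y * (card A + 2)" using sum_bounded_below[of Y "card A + 2"] each by simp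
    finally show ?thesis using Y by simp
  qed
qed

section \<open>Maximal edge colorings with an odd number of colors\<close>

locale maximal_coloring =
  fixes V :: "'a set" and E :: "'a set set" and c :: "'a set \<Rightarrow> nat" and k :: nat
  assumes graph: "simple_graph V E" and card_V: "card V = 2 * k + 1"
    and maximal: "maximal_edge_coloring V E {..<2 * k + 1} c"
begin

text \<open>The neighborhood in the complement. The conjunct \<open>u \<in> V\<close> makes the
  relation symmetric for arbitrary arguments, as \<open>nbhd_graph\<close> demands.\<close>

definition N :: "'a \<Rightarrow> 'a set" where
  "N u = {v \<in> V. u \<in> V \<and> u \<noteq> v \<and> {u, v} \<notin> E}"

definition missing :: "'a \<Rightarrow> nat set" where
  "missing v = {..<2 * k + 1} - c ` {e \<in> E. v \<in> e}"

lemma finite_V: "finite V" and E_subset: "E \<subseteq> nsets V 2"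
  using graph unfolding simple_graph_def by auto

lemma finite_E: "finite E"
  using finite_subset[OF E_subset] finite_imp_finite_nsets[OF finite_V] by blast

lemma proper: "proper_edge_coloring E {..<2 * k + 1} c"
  using maximal unfolding maximal_edge_coloring_def by blast

sublocale nbhd_graph V N
  by unfold_locales (use finite_V in \<open>auto simp: N_def insert_commute\<close>)

lemma card_incident:
  assumes "v \<in> V"
  shows "card {e \<in> E. v \<in> e} + card (N v) = 2 * k"
proof -
  have eq: "{e \<in> E. v \<in> e} = (\<lambda>w. {v, w}) ` (V - {v} - N v)"
  proof
    show "{e \<in> E. v \<in> e} \<subseteq> (\<lambda>w. {v, w}) ` (V - {v} - N v)"
    proof
      fix e assume e: "e \<in> {e \<in> E. v \<in> e}"
      then obtain x y where xy: "e = {x, y}" "x \<in> V" "y \<in> V" "x \<noteq> y"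
        using E_subset unfolding nsets_2_eq by blast
      define w where "w = (if x = v then y else x)"
      have "e = {v, w}" "w \<in> V" "w \<noteq> v" using e xy w_def by auto
      then show "e \<in> (\<lambda>w. {v, w}) ` (V - {v} - N v)" using e unfolding N_def by auto
    qed
    show "(\<lambda>w. {v, w}) ` (V - {v} - N v) \<subseteq> {e \<in> E. v \<in> e}" using assms unfolding N_def by auto
  qed
  have "card {e \<in> E. v \<in> e} = card (V - {v} - N v)"
    unfolding eq by (rule card_image) (auto simp: inj_on_def doubleton_eq_iff)
  also have "\<dots> = card (V - {v}) - card (N v)"
    using N_subset[of v] N_irrefl[of v] by (intro card_Diff_subset finite_N) auto
  finally have "card {e \<in> E. v \<in> e} = 2 * k - card (N v)"
    using assms finite_V card_V by simp
  moreover have "card (N v) \<le> card (V - {v})"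
    using N_subset[of v] N_irrefl[of v] finite_V by (intro card_mono) auto
  ultimately show ?thesis using assms finite_V card_V by simp
qed

lemma finite_missing: "finite (missing v)" and missing_subset: "missing v \<subseteq> {..<2 * k + 1}"
  unfolding missing_def by auto

lemma card_missing:
  assumes "v \<in> V"
  shows "card (missing v) = card (N v) + 1"
proof -
  have "inj_on c {e \<in> E. v \<in> e}"
    using proper_edge_coloringD[OF proper] by (auto intro!: inj_onI)
  then have "card (c ` {e \<in> E. v \<in> e}) = card {e \<in> E. v \<in> e}" by (rule card_image)
  moreover have "c ` {e \<in> E. v \<in> e} \<subseteq> {..<2 * k + 1}"
    using proper unfolding proper_edge_coloring_def by auto
  ultimately have "card (missing v) = 2 * k + 1 - card {e \<in> E. v \<in> e}"
    unfolding missing_def using finite_E by (simp add: card_Diff_subset)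
  then show ?thesis using card_incident[OF assms] by linarith
qed

lemma color_present:
  assumes "v \<in> N u" "a < 2 * k + 1"
  shows "\<exists>e\<in>E. (u \<in> e \<or> v \<in> e) \<and> c e = a"
  using maximal assms unfolding maximal_edge_coloring_iff N_def by auto

lemma missing_disjoint:
  assumes "v \<in> N u"
  shows "missing u \<inter> missing v = {}"
  using color_present[OF assms] unfolding missing_def by blast

lemma sum_degrees: "(\<Sum>v\<in>V. d v) + 2 * int (card E) = 2 * int k * (2 * int k + 1)"
proof -
  have "(\<Sum>v\<in>V. card {e \<in> E. v \<in> e}) = (\<Sum>e\<in>E. 2)"
  proof (rule sum_multicount_gen[OF finite_V finite_E], rule ballI)
    fix e assume "e \<in> E"
    then have "e \<subseteq> V" "card e = 2" using E_subset unfolding nsets_def by auto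
    moreover then have "{v \<in> V. v \<in> e} = e" by blast
    ultimately show "card {v \<in> V. v \<in> e} = 2" by simp
  qed
  then have E2: "(\<Sum>v\<in>V. card {e \<in> E. v \<in> e}) = 2 * card E" by simp
  have "(\<Sum>v\<in>V. card (N v)) + 2 * card E = (\<Sum>v\<in>V. card {e \<in> E. v \<in> e} + card (N v))"
    by (simp add: sum.distrib E2)
  also have "\<dots> = (\<Sum>v\<in>V. 2 * k)" using card_incident by (intro sum.cong) auto
  also have "\<dots> = (2 * k + 1) * (2 * k)" using card_V by simp
  finally have "int ((\<Sum>v\<in>V. card (N v)) + 2 * card E) = int ((2 * k + 1) * (2 * k))" by simp
  then show ?thesis by (simp add: algebra_simps)
qed

text \<open>The colors missing at \<open>u\<close> and those missing at \<open>v\<close> partition the palette; counting the edges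
  of either kind separately falls short by one, and parity excludes the case of equality.\<close>

lemma card_E_complementary:
  assumes uv: "v \<in> N u" and deg: "card (N u) + card (N v) = 2 * k - 1" and k: "k \<ge> 1"
  shows "card E \<ge> k * k + 2 * k"
proof (rule ccontr)
  assume "\<not> ?thesis"
  then have small: "card E + 1 \<le> k * k + 2 * k" by simp
  have uvV: "u \<in> V" "v \<in> V" using uv unfolding N_def by auto
  define A where "A = N v"
  define B where "B = N u"
  define Y where "Y = missing v"
  define X where "X = missing u"
  have XY: "X \<inter> Y = {}" unfolding X_def Y_def by (rule missing_disjoint[OF uv])
  have finXY: "finite X" "finite Y" unfolding X_def Y_def by (auto simp: finite_missing)
  have cX: "card X = card B + 1" and cY: "card Y = card A + 1"
    unfolding X_def Y_def A_def B_def using card_missing uvV by auto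
  have "card (X \<union> Y) = 2 * k + 1"
    using card_Un_disjoint[OF finXY XY] cX cY deg k A_def B_def by simp
  then have cover: "X \<union> Y = {..<2 * k + 1}"
    using missing_subset unfolding X_def Y_def by (intro card_subset_eq) auto
  have fin: "finite A" "finite B" unfolding A_def B_def by (auto simp: finite_N)
  have AB: "A \<inter> B = {}"
  \<comment> \<open>A common neighbor of \<open>u\<close> and \<open>v\<close> in the complement
    would miss no color, yet every vertex misses at least one.\<close>
  proof (rule ccontr)
    assume "A \<inter> B \<noteq> {}"
    then obtain w where w: "w \<in> N v" "w \<in> N u" unfolding A_def B_def by blast
    then have "missing w \<inter> (X \<union> Y) = {}"
      using missing_disjoint unfolding X_def Y_def by blast
    then have "missing w = {}" using cover missing_subset by blast
    moreover have "w \<in> V" using w N_subset by blast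
    ultimately show False using card_missing by fastforce
  qed
  have seen: "\<exists>e\<in>E. a \<in> e \<and> c e = y" if "a \<in> N x" "y \<in> missing x" for a x y
    using color_present[OF that(1), of y] that(2) unfolding missing_def by auto
  have seenA: "\<forall>a\<in>A. \<forall>y\<in>Y. \<exists>e\<in>E. a \<in> e \<and> c e = y"
    and seenB: "\<forall>a\<in>B. \<forall>y\<in>X. \<exists>e\<in>E. a \<in> e \<and> c e = y"
    using seen unfolding A_def B_def X_def Y_def by blast+
  note countA = card_edges_with_colors[OF finite_E E_subset proper fin(1) finXY(2) cY seenA]
  note countB = card_edges_with_colors[OF finite_E E_subset proper fin(2) finXY(1) cX seenB]
  let ?EX = "{e\<in>E. c e \<in> X}" and ?EY = "{e\<in>E. c e \<in> Y}"
  have in_XY: "c e \<in> X \<or> c e \<in> Y" if "e \<in> E" for e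
    using that cover proper unfolding proper_edge_coloring_def by blast
  have "E = ?EX \<union> ?EY" using in_XY by blast
  moreover have "?EX \<inter> ?EY = {}" using XY by blast
  ultimately have cE: "card E = card ?EX + card ?EY"
    using card_Un_disjoint[of ?EX ?EY] finite_E by (metis finite_Un)
  have ab: "card A + card B = 2 * k - 1" using deg A_def B_def by simp
  have quad: "2 * (k * k + 2 * k) \<le> card A * (card A + 3) + card B * (card B + 3) + 2"
  proof -
    define a b K where "a = int (card A)" and "b = int (card B)" and "K = int k"
    have b: "b = 2 * K - 1 - a" using ab k unfolding a_def b_def K_def by linarith
    \<comment> \<open>A product of consecutive integers; twice this product is the difference of the
      two sides of the inequality sought.\<close>
    have "(a - K) * (a - K + 1) \<ge> 0"
      by (cases "a - K \<ge> 0") (auto intro: mult_nonneg_nonneg mult_nonpos_nonpos)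
    then have "2 * (K * K + 2 * K) \<le> a * (a + 3) + b * (b + 3) + 2"
      unfolding b by (simp add: algebra_simps)
    then have "int (2 * (k * k + 2 * k)) \<le> int (card A * (card A + 3) + card B * (card B + 3) + 2)"
      unfolding a_def b_def K_def by (simp add: algebra_simps)
    then show ?thesis by linarith
  qed
  \<comment> \<open>The two lower bounds from \<open>countA\<close> and \<open>countB\<close>
    already add up to at least \<open>2 * card E\<close>, so both are attained.\<close>
  have tight: "2 * y \<le> a \<and> 2 * x \<le> b"
    if "a \<le> 2 * y" "b \<le> 2 * x" "2 * s \<le> a + b + 2" "m = x + y" "m + 1 \<le> s" for a b x y s m :: nat
    using that by linarith
  note tight = tight[OF countA(1) countB(1) quad cE small]
  note tightA = tight[THEN conjunct1] and tightB = tight[THEN conjunct2]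
  note meetA = countA(2)[OF tightA] and meetB = countB(2)[OF tightB]
  \<comment> \<open>Two vertices lie outside \<open>A\<close> and \<open>B\<close>. By tightness
    every edge meets \<open>A\<close> or \<open>B\<close>, so these two are not joined by an edge of
    \<open>E\<close>.\<close>
  define R where "R = V - (A \<union> B)"
  have "card R = 2"
  proof -
    have "A \<union> B \<subseteq> V" using N_subset A_def B_def by auto
    then have "card R = card V - card (A \<union> B)" unfolding R_def using fin by (intro card_Diff_subset) auto
    then show ?thesis using card_Un_disjoint[OF fin AB] ab card_V k by simp
  qed
  then obtain r r' where R: "R = {r, r'}" "r \<noteq> r'" by (meson card_2_iff)
  have rV: "r \<in> V" "r' \<in> V" and rAB: "r \<notin> A" "r' \<notin> A" "r \<notin> B" "r' \<notin> B" using R R_def by auto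
  have "{r, r'} \<notin> E"
  proof
    assume "{r, r'} \<in> E"
    then have "{r, r'} \<inter> A \<noteq> {} \<or> {r, r'} \<inter> B \<noteq> {}" using in_XY meetA meetB by blast
    then show False using rAB by auto
  qed
  then have rr: "r' \<in> N r" using rV R N_def by auto
  \<comment> \<open>By maximality each color occurs at \<open>r\<close> or \<open>r'\<close>; if all
    its edges meet \<open>S\<close>, such an edge has exactly one end in \<open>S\<close>.\<close>
  have leaving: "\<exists>e\<in>E. c e = y \<and> card (e \<inter> S) = 1"
    if y: "y < 2 * k + 1" and S: "r \<notin> S" "r' \<notin> S"
      and meet: "\<And>e. e \<in> E \<Longrightarrow> c e = y \<Longrightarrow> e \<inter> S \<noteq> {}" for y S
  proof -
    obtain e where e: "e \<in> E" "r \<in> e \<or> r' \<in> e" "c e = y" using color_present[OF rr y] by blast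
    have ce: "finite e" "card e = 2" using e E_subset unfolding nsets_def by auto
    have "card (e \<inter> S) < card e" using e S ce by (intro psubset_card_mono) auto
    moreover have "card (e \<inter> S) > 0" using meet[OF e(1,3)] ce by (simp add: card_gt_0_iff)
    ultimately show ?thesis using e ce by (intro bexI[of _ e]) auto
  qed
  have "even (card A) \<or> even (card B)" using ab k by presburger
  then show False
  proof
    assume "even (card A)"
    then have "(card A + 1) * (card A + 2) \<le> 2 * card ?EY"
      by (intro countA(3) leaving meetA) (use cover rAB in auto)
    then show False using tightA by (simp add: algebra_simps)
  next
    assume "even (card B)"
    then have "(card B + 1) * (card B + 2) \<le> 2 * card ?EX"
      by (intro countB(3) leaving meetB) (use cover rAB in auto)
    then show False using tightB by (simp add: algebra_simps)
  qed
qed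

lemma card_E_bound:
  assumes k: "k \<ge> 4"
  shows "card E \<ge> k * k + 2 * k"
proof (cases "\<exists>u v. v \<in> N u \<and> card (N u) + card (N v) = 2 * k - 1")
  case True
  then show ?thesis using card_E_complementary k by auto
next
  case False
  have inV: "x \<in> V" "y \<in> V" if "y \<in> N x" for x y using that unfolding N_def by auto
  let ?P = "{..<2 * k + 1}"
  \<comment> \<open>Written as sums over the palette, degree sums can be bounded color by
    color.\<close>
  have dcard: "d v + 1 = (\<Sum>a\<in>?P. if a \<in> missing v then 1 else 0)" if "v \<in> V" for v
  proof -
    have "int (card (missing v)) = (\<Sum>a\<in>?P. if a \<in> missing v then 1 else 0)"
      unfolding sum.If_cases[OF finite_lessThan] using missing_subset[of v]
      by (simp add: Int_absorb1 Collect_mem_eq del: lessThan_Suc)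
    then show ?thesis using card_missing[OF that] by (simp del: sum.lessThan_Suc)
  qed
  have edge: "d x + d y \<le> 2 * int k - 2" if xy: "y \<in> N x" for x y
  proof -
    have "card (missing x) + card (missing y) = card (missing x \<union> missing y)"
      using missing_disjoint[OF xy] by (intro card_Un_disjoint[symmetric] finite_missing)
    also have "\<dots> \<le> card ?P" using missing_subset by (intro card_mono) auto
    finally have "card (N x) + card (N y) \<le> 2 * k - 1"
      using card_missing inV[OF xy] by simp
    moreover have "card (N x) + card (N y) \<noteq> 2 * k - 1" using False xy by blast
    ultimately show ?thesis using k by linarith
  qed
  have tri: "d x + d y + d z \<le> 2 * int k - 2" if "y \<in> N x" "z \<in> N y" "x \<in> N z" for x y z
  proof -
    have "(d x + 1) + (d y + 1) + (d z + 1) = (\<Sum>a\<in>?P. (if a \<in> missing x then 1 else 0) +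
        (if a \<in> missing y then 1 else 0) + (if a \<in> missing z then 1 else 0))"
      using dcard inV[OF that(1)] inV[OF that(2)] by (simp add: sum.distrib)
    \<comment> \<open>Each color is missing at no more than one of three mutually adjacent
      vertices.\<close>
    also have "\<dots> \<le> int (card ?P) * 1"
      using missing_disjoint[OF that(1)] missing_disjoint[OF that(2)] missing_disjoint[OF that(3)]
      by (intro sum_bounded_above) auto
    finally show ?thesis by simp
  qed
  have pent: "d x1 + d x2 + d x3 + d x4 + d x5 \<le> 4 * int k - 3"
    if "x2 \<in> N x1" "x3 \<in> N x2" "x4 \<in> N x3" "x5 \<in> N x4" "x1 \<in> N x5" for x1 x2 x3 x4 x5
  proof -
    have "(d x1 + 1) + (d x2 + 1) + (d x3 + 1) + (d x4 + 1) + (d x5 + 1) =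
        (\<Sum>a\<in>?P. (if a \<in> missing x1 then 1 else 0) + (if a \<in> missing x2 then 1 else 0) +
        (if a \<in> missing x3 then 1 else 0) + (if a \<in> missing x4 then 1 else 0) +
        (if a \<in> missing x5 then 1 else 0))"
      using dcard inV[OF that(1)] inV[OF that(3)] inV[OF that(4)] by (simp add: sum.distrib)
    \<comment> \<open>Each color is missing at no two cyclically consecutive vertices, hence at no
      more than two of the five.\<close>
    also have "\<dots> \<le> int (card ?P) * 2"
      using that[THEN missing_disjoint] by (intro sum_bounded_above) auto
    finally show ?thesis by simp
  qed
  have "even ((\<Sum>v\<in>V. d v) + 2 * int (card E))" unfolding sum_degrees by simp
  then have ev: "even (\<Sum>v\<in>V. d v)" by simp
  have "(\<Sum>v\<in>V. d v) \<le> 2 * int k * (int k - 1)"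
    by (rule degree_sum_bound[OF card_V k edge tri pent ev])
  then have "2 * int (card E) \<ge> 2 * (int k * int k + 2 * int k)"
    using sum_degrees by (simp add: algebra_simps)
  then have "int (card E) \<ge> int (k * k + 2 * k)" by simp
  then show ?thesis by linarith
qed

end

text \<open>For \<open>n = 2 * k + 1\<close> the bound is exactly \<open>k * k + 2 * k\<close>, and
  \<open>n \<ge> 9\<close> means \<open>k \<ge> 4\<close>.\<close>

lemma card_edges_ge:
  fixes n :: nat
  assumes "n \<ge> 9" "odd n" "simple_graph V E" "card V = n" "has_maximal_edge_coloring V E"
  shows "real (card E) \<ge> 1/4 * (real n)^2 + 1/2 * real n - 3/4"
proof -
  obtain k where k: "n = 2 * k + 1" using assms(2) by (elim oddE)
  obtain c where "maximal_edge_coloring V E {..<n} c"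
    using assms chromatic_index_complete_odd unfolding has_maximal_edge_coloring_def by auto
  then interpret maximal_coloring V E c k
    using assms k by unfold_locales auto
  have "card E \<ge> k * k + 2 * k" using card_E_bound assms(1) k by simp
  then have "real (card E) \<ge> real (k * k + 2 * k)" by (simp only: of_nat_le_iff)
  then show ?thesis unfolding k by (simp add: power2_eq_square field_simps)
qed

theorem theorem5:
  fixes n :: nat
  assumes "n \<ge> 9" and "odd n"
  shows "(\<forall>(V :: 'a set) E. simple_graph V E \<and> card V = n \<and> has_maximal_edge_coloring V E \<longrightarrow>
            real (card E) \<ge> 1/4 * (real n)^2 + 1/2 * real n - 3/4) \<and>
         (\<forall>m \<in> MEC n. real m \<ge> 1/4 * (real n)^2 + 1/2 * real n - 3/4)"
  using card_edges_ge[OF assms, where 'a = 'a] card_edges_ge[OF assms, where 'a = nat]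
  unfolding MEC_def by blast

end
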